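(* Let $M$ and $N$ be two quasianalytic weight sequences and assume $\lim_{k\to+\infty}n_k^{1/k}=+\infty$ (i.e. $\mathcal O^{0,r}\subsetneq\mathcal E^{0,r}_{(N)}$). Then $j^\infty(\mathcal E^{0,r}_{\{M\}})\cap\Lambda^r_{(N)}$ is Haar-null in $\Lambda^r_{(N)}$.
   Context: For a sequence $M=(M_p)_{p\in\mathbb N}$ of positive reals write $m_p:=M_p/p!$ (and $n_p:=N_p/p!$). $M$ is a weight sequence if $1=M_0\le M_1$, $M_p^2\le M_{p-1}M_{p+1}$ for all $p\ge1$, and $\liminf_{p\to\infty}m_p^{1/p}>0$; it is quasianalytic if $\sum_{p\ge1}M_{p-1}/M_p=+\infty$. For $U\subseteq\mathbb R^r$ open, $K\subseteq U$ compact, $h>0$: $\|f\|^M_{K,h}:=\sup_{\alpha\in\mathbb N^r,x\in K}|\partial^\alpha f(x)|/(h^{|\alpha|}M_{|\alpha|})$. $\mathcal E_{\{M\}}(U)$ consists of smooth $f$ such that for every compact $K\subseteq U$ there exists $h>0$ with $\|f\|^M_{K,h}<\infty$; $\mathcal E_{(M)}(U)$: for every compact $K$ and every $h>0$. $\mathcal E^{0,r}_{\{M\}}$, $\mathcal E^{0,r}_{(M)}$ are the spaces of germs at $0\in\mathbb R^r$ of functions in the respective class on some cube $(-1/k,1/k)^r$; $\mathcal O^{0,r}$ denotes germs at $0$ of real analytic functions. For $\mathbf b=(b_\alpha)_{\alpha\in\mathbb N^r}$ and $h>0$: $|\mathbf b|^N_h:=\sup_\alpha|b_\alpha|/(h^{|\alpha|}n_{|\alpha|})$;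 $\Lambda^r_{(N)}:=\{\mathbf b:\forall h>0,|\mathbf b|^N_h<\infty\}$, a Fréchet space with the seminorms $|\cdot|^N_h$, $h>0$. The Borel map is $j^\infty(f)=(\partial^\alpha f(0)/|\alpha|!)_{\alpha\in\mathbb N^r}$. In a complete metric vector space $X$, a Borel set $B$ is Haar-null if there is a compactly supported Borel probability measure $\mu$ with $\mu(x+B)=0$ for all $x\in X$; an arbitrary set is Haar-null if it is contained in a Haar-null Borel set. *)

theory Defs
  imports "HOL-Probability.Probability"
begin

definition weight_seq :: "(nat \<Rightarrow> real) \<Rightarrow> bool" where
  "weight_seq M \<longleftrightarrow> (\<forall>p. M p > 0) \<and> M 0 = 1 \<and> M 0 \<le> M 1 \<and>
     (\<forall>p\<ge>1. (M p)^2 \<le> M (p - 1) * M (p + 1)) \<and>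
     liminf (\<lambda>p. ereal (root p (M p / fact p))) > 0"

text \<open>quasianalytic: sum over p >= 1 of M(p-1)/M(p) diverges (terms are positive)\<close>
definition quasianalytic :: "(nat \<Rightarrow> real) \<Rightarrow> bool" where
  "quasianalytic M \<longleftrightarrow> \<not> summable (\<lambda>p. M p / M (Suc p))"

definition partial :: "'n::finite \<Rightarrow> (real^'n \<Rightarrow> real) \<Rightarrow> real^'n \<Rightarrow> real" where
  "partial i f x = deriv (\<lambda>t. f (x + t *\<^sub>R axis i 1)) 0"

fun iter_partial :: "'n::finite list \<Rightarrow> (real^'n \<Rightarrow> real) \<Rightarrow> real^'n \<Rightarrow> real" where
  "iter_partial [] f = f"
| "iter_partial (i # ds) f = partial i (iter_partial ds f)"

definition smooth_on :: "(real^'n::finite) set \<Rightarrow> (real^'n \<Rightarrow> real) \<Rightarrow> bool" where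
  "smooth_on U f \<longleftrightarrow> (\<forall>ds. continuous_on U (iter_partial ds f) \<and>
      (\<forall>i. \<forall>x\<in>U. (\<lambda>t. iter_partial ds f (x + t *\<^sub>R axis i 1)) differentiable (at 0)))"

definition mlen :: "('n::finite \<Rightarrow> nat) \<Rightarrow> nat" where
  "mlen \<alpha> = (\<Sum>i\<in>UNIV. \<alpha> i)"

text \<open>partial derivative of order alpha (order of differentiation is irrelevant for smooth f)\<close>
definition dpow :: "('n::finite \<Rightarrow> nat) \<Rightarrow> (real^'n \<Rightarrow> real) \<Rightarrow> real^'n \<Rightarrow> real" where
  "dpow \<alpha> f = iter_partial (SOME ds. \<forall>i. count_list ds i = \<alpha> i) f"

definition E_roum :: "(nat \<Rightarrow> real) \<Rightarrow> (real^'n::finite) set \<Rightarrow> (real^'n \<Rightarrow> real) set" where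
  "E_roum M U = {f. smooth_on U f \<and> (\<forall>K. compact K \<and> K \<subseteq> U \<longrightarrow>
      (\<exists>h>0. \<exists>C. \<forall>\<alpha>. \<forall>x\<in>K. \<bar>dpow \<alpha> f x\<bar> \<le> C * h ^ mlen \<alpha> * M (mlen \<alpha>)))}"

definition cube :: "nat \<Rightarrow> (real^'n::finite) set" where
  "cube k = {x. \<forall>i. \<bar>x $ i\<bar> < 1 / real k}"

definition jet :: "(real^'n::finite \<Rightarrow> real) \<Rightarrow> ('n \<Rightarrow> nat) \<Rightarrow> real" where
  "jet f = (\<lambda>\<alpha>. dpow \<alpha> f 0 / fact (mlen \<alpha>))"

definition jet_germ_roum :: "(nat \<Rightarrow> real) \<Rightarrow> (('n::finite \<Rightarrow> nat) \<Rightarrow> real) set" where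
  "jet_germ_roum M = {jet f | f. \<exists>k::nat. k \<ge> 1 \<and> f \<in> E_roum M (cube k)}"

definition lam_bounded :: "(nat \<Rightarrow> real) \<Rightarrow> real \<Rightarrow> (('n::finite \<Rightarrow> nat) \<Rightarrow> real) \<Rightarrow> bool" where
  "lam_bounded N h b \<longleftrightarrow> bdd_above (range (\<lambda>\<alpha>. \<bar>b \<alpha>\<bar> / (h ^ mlen \<alpha> * (N (mlen \<alpha>) / fact (mlen \<alpha>)))))"

definition lam_norm :: "(nat \<Rightarrow> real) \<Rightarrow> real \<Rightarrow> (('n::finite \<Rightarrow> nat) \<Rightarrow> real) \<Rightarrow> real" where
  "lam_norm N h b = (SUP \<alpha>. \<bar>b \<alpha>\<bar> / (h ^ mlen \<alpha> * (N (mlen \<alpha>) / fact (mlen \<alpha>))))"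

definition Lam_beur :: "(nat \<Rightarrow> real) \<Rightarrow> (('n::finite \<Rightarrow> nat) \<Rightarrow> real) set" where
  "Lam_beur N = {b. \<forall>h>0. lam_bounded N h b}"

definition lam_top :: "(nat \<Rightarrow> real) \<Rightarrow> (('n::finite \<Rightarrow> nat) \<Rightarrow> real) topology" where
  "lam_top N = topology (\<lambda>S. S \<subseteq> Lam_beur N \<and> (\<forall>x\<in>S. \<exists>hs. finite hs \<and> (\<forall>h\<in>hs. h > 0) \<and>
      (\<exists>e>0. {y \<in> Lam_beur N. \<forall>h\<in>hs. lam_norm N h (\<lambda>\<alpha>. y \<alpha> - x \<alpha>) < e} \<subseteq> S)))"

definition lam_borel :: "(nat \<Rightarrow> real) \<Rightarrow> (('n::finite \<Rightarrow> nat) \<Rightarrow> real) measure" where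
  "lam_borel N = sigma (Lam_beur N) {S. openin (lam_top N) S}"

definition haar_null_borel :: "(nat \<Rightarrow> real) \<Rightarrow> (('n::finite \<Rightarrow> nat) \<Rightarrow> real) set \<Rightarrow> bool" where
  "haar_null_borel N B \<longleftrightarrow> B \<in> sets (lam_borel N) \<and>
     (\<exists>\<mu>. prob_space \<mu> \<and> sets \<mu> = sets (lam_borel N) \<and> space \<mu> = Lam_beur N \<and>
        (\<exists>K. compactin (lam_top N) K \<and> K \<in> sets \<mu> \<and> emeasure \<mu> K = 1) \<and>
        (\<forall>x\<in>Lam_beur N. emeasure \<mu> ((\<lambda>y. \<lambda>\<alpha>. x \<alpha> + y \<alpha>) ` B) = 0))"

definition haar_null :: "(nat \<Rightarrow> real) \<Rightarrow> (('n::finite \<Rightarrow> nat) \<Rightarrow> real) set \<Rightarrow> bool" where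
  "haar_null N A \<longleftrightarrow> (\<exists>B. haar_null_borel N B \<and> A \<subseteq> B)"

end

theory Submission
  imports Defs
begin

text \<open>
  The jets in question form a linear subspace, so it suffices to exhibit one \<open>b \<in> \<Lambda>\<^sub>(\<^sub>N\<^sub>)\<close> outside it:
  every line in direction \<open>b\<close> then meets a translate of the subspace at most once, and the uniform
  measure on \<open>{t b : 0 \<le> t \<le> 1}\<close> is a witness. Take \<open>b\<^sub>\<alpha> = (n\<^bsub>|\<alpha>|\<^esub>)\<^bsup>1/2\<^esup>\<close>. Restricted to a coordinate axis,
  a function with jet \<open>b\<close> would be a quasianalytic function of one variable with nonnegative
  derivatives at 0. By Bang's method its derivatives stay nonnegative on an interval \<open>[0, a]\<close>, so
  Taylor's formula gives \<open>f\<^bsup>(j)\<^esup>(0) a\<^sup>j / j! \<le> f(a)\<close>, contradicting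
  \<open>b\<^sub>j\<^bsup>1/j\<^esup> \<rightarrow> \<infinity>\<close>. The subspace is a countable union of sets on which all constants are fixed; as the
  argument is quantitative, it survives passing to their closures, and this yields a Borel superset.
\<close>

section \<open>Propagation of positivity in quasianalytic classes\<close>

text \<open>The derivatives are two-sided even at the end points \<open>0\<close> and
  \<open>a\<close>. Restrictions of germs to a coordinate axis satisfy this, and it is the form in
  which \<open>Taylor_up\<close> applies.\<close>

definition deriv_tower :: "real \<Rightarrow> (nat \<Rightarrow> real) \<Rightarrow> (nat \<Rightarrow> real \<Rightarrow> real) \<Rightarrow> bool" where
  "deriv_tower a L F \<longleftrightarrow>
     (\<forall>j. \<forall>t\<in>{0..a}. (F j has_real_derivative F (Suc j) t) (at t) \<and> \<bar>F j t\<bar> \<le> L j)"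

lemma deriv_tower_diff:
  assumes "deriv_tower a L F" "deriv_tower a L G"
  shows "deriv_tower a (\<lambda>j. 2 * L j) (\<lambda>j t. F j t - G j t)"
  unfolding deriv_tower_def
proof (intro allI ballI conjI)
  fix j t assume t: "t \<in> {0..a}"
  show "((\<lambda>t. F j t - G j t) has_real_derivative F (Suc j) t - G (Suc j) t) (at t)"
    using assms t by (intro DERIV_diff) (auto simp: deriv_tower_def)
  have "\<bar>F j t\<bar> \<le> L j" "\<bar>G j t\<bar> \<le> L j"
    using assms t by (auto simp: deriv_tower_def)
  then show "\<bar>F j t - G j t\<bar> \<le> 2 * L j" by linarith
qed

text \<open>In contrast to \<open>weight_seq\<close> nothing is normalized at index 0, so that the
  property survives the rescaling to \<open>2 * real (Suc m) ^ Suc j * M j\<close>.\<close>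

definition log_convex_seq :: "(nat \<Rightarrow> real) \<Rightarrow> bool" where
  "log_convex_seq L \<longleftrightarrow> (\<forall>p. L p > 0) \<and> (\<forall>p. (L (Suc p))\<^sup>2 \<le> L p * L (Suc (Suc p)))"

lemma log_convex_seq_ratio_mono:
  assumes "log_convex_seq L" "p \<le> q"
  shows "L (Suc p) / L p \<le> L (Suc q) / L q"
  using assms(2)
proof (rule lift_Suc_mono_le[rotated])
  fix n
  have "L n > 0" "L (Suc n) > 0" "(L (Suc n))\<^sup>2 \<le> L n * L (Suc (Suc n))"
    using assms(1) by (auto simp: log_convex_seq_def)
  then show "L (Suc n) / L n \<le> L (Suc (Suc n)) / L (Suc n)"
    by (simp add: field_simps power2_eq_square)
qed

text \<open>The quotient of the two values of \<open>L\<close> is a product of \<open>i\<close>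
  consecutive ratios, and up to index \<open>n\<close> none of them exceeds the last one.\<close>

lemma log_convex_seq_le_power:
  assumes L: "log_convex_seq L" and "j + i \<le> Suc n"
  shows "L (j + i) \<le> L j * (L (Suc n) / L n) ^ i"
  using assms(2)
proof (induction i)
  case (Suc i)
  have pos: "L p > 0" for p using L by (simp add: log_convex_seq_def)
  have "L (j + Suc i) = L (j + i) * (L (Suc (j + i)) / L (j + i))"
    using pos[of "j + i"] by simp
  also have "\<dots> \<le> (L j * (L (Suc n) / L n) ^ i) * (L (Suc n) / L n)"
  proof (rule mult_mono)
    show "L (j + i) \<le> L j * (L (Suc n) / L n) ^ i" using Suc by simp
    show "L (Suc (j + i)) / L (j + i) \<le> L (Suc n) / L n"
      using Suc by (intro log_convex_seq_ratio_mono[OF L]) simp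
  qed (use pos in \<open>auto intro!: mult_nonneg_nonneg divide_nonneg_nonneg less_imp_le\<close>)
  finally show ?case by (simp add: mult_ac)
qed simp

lemma sum_power_fact_le_exp:
  fixes x :: real
  assumes "x \<ge> 0"
  shows "(\<Sum>i<n. x ^ i / fact i) \<le> exp x"
proof -
  have "(\<lambda>i. x ^ i / fact i) sums exp x"
    using exp_converges[of x] by (simp add: field_simps)
  then show ?thesis
    using sum_le_suminf[of "\<lambda>i. x ^ i / fact i" "{..<n}"] assms
    by (auto simp: sums_iff)
qed

text \<open>Bang's propagation estimate for the one-sided quantity
  \<open>sup\<^sub>j max(0, - F\<^sub>j(t)) / (e\<^sup>j L\<^sub>j)\<close>: only lower bounds for the derivatives enter,
  because all Taylor coefficients are taken at the left end point.\<close>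

lemma deriv_tower_lower_bound_propagates:
  assumes F: "deriv_tower a L F" and L: "log_convex_seq L"
    and xy: "0 \<le> x" "x \<le> y" "y \<le> a"
    and s: "exp (- real (Suc n)) \<le> s"
    and low: "\<And>j. F j x \<ge> - (s * exp j * L j)"
  shows "F j y \<ge> - (s * exp (exp 1 * (y - x) * (L (Suc n) / L n)) * exp j * L j)"
proof -
  have pos: "L p > 0" for p using L by (simp add: log_convex_seq_def)
  have s0: "s > 0" using s by (rule less_le_trans[OF exp_gt_zero])
  \<comment> \<open>With this \<open>u\<close> the \<open>i\<close>-th Taylor term is at least
    \<open>- (s * exp j * L j)\<close> times \<open>u ^ i / fact i\<close>, so the exponential
    series dominates the expansion. The factor \<open>exp 1\<close> comes from splitting
    \<open>exp (j + i)\<close>.\<close>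
  define u where "u = exp 1 * (y - x) * (L (Suc n) / L n)"
  have u0: "u \<ge> 0" using xy pos[of n] pos[of "Suc n"] by (auto simp: u_def)
  have bound: "\<bar>F j t\<bar> \<le> L j" if "t \<in> {0..a}" for j t
    using F that by (auto simp: deriv_tower_def)
  show ?thesis
  proof (cases "y = x")
    case True
    then show ?thesis using low[of j] by simp
  next
    case False
    then have "x < y" using xy by simp
    show ?thesis
    proof (cases "j \<le> n")
      case False
      \<comment> \<open>For \<open>j > n\<close> the weight \<open>s * exp j\<close> is at least 1,
        so the claim is weaker than the a priori bound by \<open>L j\<close>.\<close>
      have "exp (- real (Suc n)) * exp j \<ge> 1"
        using False by (simp flip: exp_add)
      moreover have "exp (- real (Suc n)) * exp j \<le> s * exp j"
        using s by (intro mult_right_mono) auto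
      moreover have "s * exp j * 1 \<le> s * exp j * exp u"
        using s0 u0 by (intro mult_left_mono) auto
      ultimately have "1 \<le> s * exp j * exp u" by linarith
      then have "L j * 1 \<le> L j * (s * exp j * exp u)"
        using pos[of j] by (intro mult_left_mono) auto
      then have "- (s * exp u * exp j * L j) \<le> - L j" by (simp add: mult_ac)
      also have "\<dots> \<le> F j y" using bound[of y j] xy by auto
      finally show ?thesis by (simp add: u_def)
    next
      case True
      \<comment> \<open>The expansion stops exactly at order \<open>n + 1\<close>, where
        \<open>s * exp (n + 1) \<ge> 1\<close> and the a priori bound takes care of the
        remainder.\<close>
      define k where "k = Suc n - j"
      have k: "k > 0" "j + k = Suc n" using True by (auto simp: k_def)
      have "\<exists>t. x < t \<and> t < y \<and> F j y =
          (\<Sum>i<k. (F (j + i) x / fact i) * (y - x) ^ i) + (F (j + k) t / fact k) * (y - x) ^ k"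
        using F \<open>x < y\<close> xy k
        by (intro Taylor_up[where a = x]) (auto simp: deriv_tower_def)
      then obtain t where t: "x < t" "t < y" and taylor: "F j y =
          (\<Sum>i<k. (F (j + i) x / fact i) * (y - x) ^ i) + (F (j + k) t / fact k) * (y - x) ^ k"
        by blast
      \<comment> \<open>The value \<open>v\<close> is kept abstract so as to cover both the
        coefficients at \<open>x\<close> and the remainder, whose derivative is taken at an
        intermediate point where \<open>low\<close> says nothing.\<close>
      have term_bound: "(v / fact i) * (y - x) ^ i \<ge> - (s * exp j * L j * (u ^ i / fact i))"
        if v: "v \<ge> - (s * exp (real (j + i)) * L (j + i))" and i: "i \<le> k" for v i
      proof -
        have "L (j + i) \<le> L j * (L (Suc n) / L n) ^ i"
          using i k by (intro log_convex_seq_le_power[OF L]) simp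
        then have "s * exp (real (j + i)) * L (j + i)
            \<le> s * exp (real (j + i)) * (L j * (L (Suc n) / L n) ^ i)"
          using s0 by (intro mult_left_mono) auto
        also have "\<dots> = s * exp j * L j * (exp 1 * (L (Suc n) / L n)) ^ i"
          using exp_of_nat_mult[of i "1::real"]
          unfolding power_mult_distrib by (simp add: exp_add)
        finally have "v \<ge> - (s * exp j * L j * (exp 1 * (L (Suc n) / L n)) ^ i)"
          using v by linarith
        then have "v * ((y - x) ^ i / fact i)
            \<ge> - (s * exp j * L j * (exp 1 * (L (Suc n) / L n)) ^ i) * ((y - x) ^ i / fact i)"
          using xy by (intro mult_right_mono) auto
        moreover have "u ^ i = (exp 1 * (L (Suc n) / L n)) ^ i * (y - x) ^ i"
          unfolding u_def power_mult_distrib by simp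
        ultimately show ?thesis by (simp add: mult_ac)
      qed
      have "F j y \<ge> (\<Sum>i<k. - (s * exp j * L j * (u ^ i / fact i)))
          + - (s * exp j * L j * (u ^ k / fact k))"
        unfolding taylor
      proof (intro add_mono sum_mono)
        fix i assume "i \<in> {..<k}"
        then show "- (s * exp j * L j * (u ^ i / fact i)) \<le> F (j + i) x / fact i * (y - x) ^ i"
          by (intro term_bound low) simp
      next
        have "exp (- real (Suc n)) * exp (real (j + k)) = 1"
          unfolding k by (simp flip: exp_add)
        then have "1 \<le> s * exp (real (j + k))"
          using mult_right_mono[OF s, of "exp (real (j + k))"] by simp
        then have "L (j + k) \<le> s * exp (real (j + k)) * L (j + k)"
          using mult_right_mono[of 1 "s * exp (real (j + k))" "L (j + k)"] pos[of "j + k"] by simp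
        moreover have "\<bar>F (j + k) t\<bar> \<le> L (j + k)" using t xy by (intro bound) auto
        ultimately show "- (s * exp j * L j * (u ^ k / fact k)) \<le> F (j + k) t / fact k * (y - x) ^ k"
          by (intro term_bound) auto
      qed
      also have "(\<Sum>i<k. - (s * exp j * L j * (u ^ i / fact i)))
          + - (s * exp j * L j * (u ^ k / fact k)) = - (s * exp j * L j * (\<Sum>i<Suc k. u ^ i / fact i))"
        by (simp add: sum_negf sum_distrib_left algebra_simps)
      finally have "F j y \<ge> - (s * exp j * L j * (\<Sum>i<Suc k. u ^ i / fact i))" .
      moreover have "s * exp j * L j * (\<Sum>i<Suc k. u ^ i / fact i) \<le> s * exp j * L j * exp u"
        using s0 pos[of j] u0 by (intro mult_left_mono sum_power_fact_le_exp) auto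
      ultimately show ?thesis by (simp add: u_def mult_ac)
    qed
  qed
qed

text \<open>Descending induction from \<open>N\<close>: on a stretch of length
  \<open>L n / (e L (n + 1))\<close> the exponent in the propagation estimate is at most 1, so one
  factor \<open>e\<close> is lost and \<open>exp (- (n + 1))\<close> becomes
  \<open>exp (- n)\<close>.\<close>

lemma deriv_tower_lower_bound:
  assumes F: "deriv_tower a L F" and L: "log_convex_seq L"
    and nonneg: "\<And>j. j \<le> N \<Longrightarrow> F j 0 \<ge> 0"
    and n: "n \<le> N" and t: "0 \<le> t" "t \<le> a" "t \<le> (\<Sum>i\<in>{n..<N}. L i / (exp 1 * L (Suc i)))"
  shows "F j t \<ge> - (exp (- real n) * exp j * L j)"
  using n t
proof (induction n arbitrary: t j rule: inc_induct)
  case base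
  \<comment> \<open>The sum over the empty range is 0. For \<open>j > N\<close> the a priori bound
    suffices again.\<close>
  have "t = 0" using base by simp
  have "L j > 0" using L by (simp add: log_convex_seq_def)
  show ?case
  proof (cases "j \<le> N")
    case True
    then have "0 \<le> F j t" using nonneg \<open>t = 0\<close> by simp
    moreover have "0 \<le> exp (- real N) * exp j * L j" using \<open>L j > 0\<close> by simp
    ultimately show ?thesis by linarith
  next
    case False
    then have "exp (- real N) * exp j \<ge> 1" by (simp flip: exp_add)
    then have "exp (- real N) * exp j * L j \<ge> L j"
      using mult_right_mono[of 1 "exp (- real N) * exp j" "L j"] \<open>L j > 0\<close> by simp
    moreover have "\<bar>F j t\<bar> \<le> L j" using F base by (auto simp: deriv_tower_def)
    ultimately show ?thesis by linarith
  qed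
next
  case (step n)
  have pos: "L p > 0" for p using L by (simp add: log_convex_seq_def)
  define T where "T = (\<Sum>i\<in>{Suc n..<N}. L i / (exp 1 * L (Suc i)))"
  have T0: "T \<ge> 0" unfolding T_def
    using pos by (intro sum_nonneg divide_nonneg_nonneg mult_nonneg_nonneg) (auto intro: less_imp_le)
  \<comment> \<open>The induction hypothesis reaches as far as \<open>T\<close>; what remains from
    \<open>x\<close> to \<open>t\<close> fits into the stretch of index \<open>n\<close>.\<close>
  define x where "x = min t T"
  have x: "0 \<le> x" "x \<le> t" "x \<le> T" using T0 step.prems by (auto simp: x_def)
  have "t \<le> L n / (exp 1 * L (Suc n)) + T"
    using step.prems(3) step.hyps by (simp add: T_def sum.atLeast_Suc_lessThan)
  moreover have "L n / (exp 1 * L (Suc n)) \<ge> 0"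
    using pos[of n] pos[of "Suc n"] by simp
  ultimately have "t - x \<le> L n / (exp 1 * L (Suc n))" by (auto simp: x_def)
  then have e: "exp 1 * (t - x) * (L (Suc n) / L n) \<le> 1"
    using pos[of n] pos[of "Suc n"] by (simp add: field_simps)
  have "F j t \<ge> - (exp (- real (Suc n)) * exp (exp 1 * (t - x) * (L (Suc n) / L n)) * exp j * L j)"
    using x step.prems
    by (intro deriv_tower_lower_bound_propagates[OF F L, where n = n] step.IH) (auto simp: T_def)
  moreover have "exp (- real (Suc n)) * exp (exp 1 * (t - x) * (L (Suc n) / L n)) * exp j * L j
      \<le> exp (- real (Suc n)) * exp 1 * exp j * L j"
    using e pos[of j] by (intro mult_right_mono mult_left_mono) auto
  moreover have "exp (- real (Suc n)) * exp 1 = exp (- real n)" by (simp flip: exp_add)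
  ultimately show ?case by (metis neg_le_iff_le order_trans)
qed

lemma not_summable_tail_sum_ge:
  fixes f :: "nat \<Rightarrow> real"
  assumes "\<not> summable f" "\<And>i. f i \<ge> 0"
  shows "\<exists>N\<ge>n. c \<le> (\<Sum>i\<in>{n..<N}. f i)"
proof (rule ccontr)
  assume "\<not> ?thesis"
  then have less: "(\<Sum>i\<in>{n..<N}. f i) \<le> c" if "N \<ge> n" for N using that by force
  have "summable (\<lambda>i. f (i + n))"
  proof (rule summableI_nonneg_bounded)
    fix k
    have "(\<Sum>i<k. f (i + n)) = (\<Sum>i\<in>{n..<k + n}. f i)"
      using sum.shift_bounds_nat_ivl[of f 0 n k] by (simp add: atLeast0LessThan)
    then show "(\<Sum>i<k. f (i + n)) \<le> c" using less[of "k + n"] by simp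
  qed (use assms in auto)
  then show False using assms(1) by (simp add: summable_iff_shift)
qed

text \<open>A finite version of Bernstein's theorem on absolutely monotone functions. The order
  \<open>N\<close> up to which positivity is needed is uniform in \<open>F\<close>, which makes the estimate stable
  under coefficientwise limits of jets.\<close>

lemma deriv_tower_coefficient_bound:
  assumes L: "log_convex_seq L" and quasi: "\<not> summable (\<lambda>p. L p / L (Suc p))" and a: "a > 0"
  shows "\<exists>N. \<forall>F. deriv_tower a L F \<longrightarrow> (\<forall>i\<le>N. F i 0 \<ge> 0) \<longrightarrow> F j 0 / fact j * a ^ j \<le> L 0 + 1"
proof -
  have pos: "L p > 0" for p using L by (simp add: log_convex_seq_def)
  \<comment> \<open>The Taylor remainder of order \<open>j + 1\<close> at \<open>a\<close> will be
    at least \<open>- exp (- n) * c\<close>. Choosing \<open>n\<close> to make this exceed -1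
    produces the summand 1 in the bound.\<close>
  define c where "c = exp (real (Suc j)) * L (Suc j) * (a ^ Suc j / fact (Suc j))"
  have "(\<lambda>n. exp (- real n) * c) \<longlonglongrightarrow> 0 * c"
  proof (intro tendsto_mult_right)
    show "(\<lambda>n. exp (- real n)) \<longlonglongrightarrow> 0"
      by (rule filterlim_compose[OF exp_at_bot])
        (simp add: filterlim_real_sequentially filterlim_uminus_at_bot)
  qed
  then have "eventually (\<lambda>n. exp (- real n) * c < 1) sequentially"
    by (intro order_tendstoD(2)[where y = "0 * c"]) auto
  then obtain n where n: "exp (- real n) * c < 1"
    by (auto simp: eventually_sequentially)
  have "\<not> summable (\<lambda>p. L p / (exp 1 * L (Suc p)))"
  proof
    assume "summable (\<lambda>p. L p / (exp 1 * L (Suc p)))"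
    then have "summable (\<lambda>p. exp 1 * (L p / (exp 1 * L (Suc p))))" by (rule summable_mult)
    then show False using quasi by simp
  qed
  moreover have "L i / (exp 1 * L (Suc i)) \<ge> 0" for i
    using pos[of i] pos[of "Suc i"] by simp
  \<comment> \<open>This is where quasianalyticity enters: even the stretches from index
    \<open>n\<close> on cover the whole interval up to \<open>a\<close>.\<close>
  ultimately obtain N0 where N0: "N0 \<ge> n" "a \<le> (\<Sum>i\<in>{n..<N0}. L i / (exp 1 * L (Suc i)))"
    using not_summable_tail_sum_ge[of "\<lambda>p. L p / (exp 1 * L (Suc p))" n a] by blast
  have "F j 0 / fact j * a ^ j \<le> L 0 + 1"
    \<comment> \<open>Positivity up to \<open>N0\<close> feeds the lower bound for the remainder;
      positivity up to \<open>j\<close> allows dropping the other Taylor terms.\<close>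
    if F: "deriv_tower a L F" and nn: "\<forall>i\<le>max N0 j. F i 0 \<ge> 0" for F
  proof -
    have "\<exists>t. 0 < t \<and> t < a \<and> F 0 a = (\<Sum>i<Suc j. (F i 0 / fact i) * (a - 0) ^ i)
        + (F (Suc j) t / fact (Suc j)) * (a - 0) ^ Suc j"
      using F a by (intro Taylor_up[where a = 0]) (auto simp: deriv_tower_def)
    then obtain t where t: "0 < t" "t < a" and taylor: "F 0 a = (\<Sum>i<Suc j. (F i 0 / fact i) * a ^ i)
        + (F (Suc j) t / fact (Suc j)) * a ^ Suc j" by auto
    have "F (Suc j) t \<ge> - (exp (- real n) * exp (real (Suc j)) * L (Suc j))"
      using nn N0 t by (intro deriv_tower_lower_bound[OF F L, where N = N0]) auto
    then have "F (Suc j) t * (a ^ Suc j / fact (Suc j))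
        \<ge> - (exp (- real n) * exp (real (Suc j)) * L (Suc j)) * (a ^ Suc j / fact (Suc j))"
      using a by (intro mult_right_mono) auto
    then have "F (Suc j) t / fact (Suc j) * a ^ Suc j \<ge> - (exp (- real n) * c)"
      by (simp add: c_def mult_ac)
    moreover have "(\<Sum>i<Suc j. (F i 0 / fact i) * a ^ i) \<ge> F j 0 / fact j * a ^ j"
      using nn a by (intro member_le_sum[where f = "\<lambda>i. (F i 0 / fact i) * a ^ i"]) auto
    moreover have "\<bar>F 0 a\<bar> \<le> L 0" using F a by (auto simp: deriv_tower_def)
    ultimately show ?thesis using taylor n by linarith
  qed
  then show ?thesis by blast
qed

section \<open>The topology of the Beurling sequence space\<close>

lemma lam_bounded_iff:
  fixes b :: "('n::finite \<Rightarrow> nat) \<Rightarrow> real"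
  assumes N: "\<And>p. N p > 0" and h: "h > 0"
  shows "lam_bounded N h b \<longleftrightarrow>
    (\<exists>C. \<forall>\<alpha>. \<bar>b \<alpha>\<bar> \<le> C * (h ^ mlen \<alpha> * (N (mlen \<alpha>) / fact (mlen \<alpha>))))"
proof -
  have "h ^ mlen \<alpha> * (N (mlen \<alpha>) / fact (mlen \<alpha>)) > 0" for \<alpha> :: "'n \<Rightarrow> nat"
    using N h by (intro mult_pos_pos divide_pos_pos) auto
  then show ?thesis
    by (simp add: lam_bounded_def bdd_above_def pos_divide_le_eq del: times_divide_eq_right)
qed

lemma abs_le_lam_norm:
  fixes b :: "('n::finite \<Rightarrow> nat) \<Rightarrow> real"
  assumes N: "\<And>p. N p > 0" and h: "h > 0" and b: "lam_bounded N h b"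
  shows "\<bar>b \<alpha>\<bar> \<le> lam_norm N h b * (h ^ mlen \<alpha> * (N (mlen \<alpha>) / fact (mlen \<alpha>)))"
proof -
  have "h ^ mlen \<alpha> * (N (mlen \<alpha>) / fact (mlen \<alpha>)) > 0"
    using N h by (intro mult_pos_pos divide_pos_pos) auto
  moreover have "\<bar>b \<alpha>\<bar> / (h ^ mlen \<alpha> * (N (mlen \<alpha>) / fact (mlen \<alpha>))) \<le> lam_norm N h b"
    using b unfolding lam_norm_def lam_bounded_def by (rule cSUP_upper[OF UNIV_I])
  ultimately show ?thesis by (simp only: pos_divide_le_eq)
qed

lemma lam_norm_le:
  fixes b :: "('n::finite \<Rightarrow> nat) \<Rightarrow> real"
  assumes N: "\<And>p. N p > 0" and h: "h > 0"
    and b: "\<And>\<alpha>. \<bar>b \<alpha>\<bar> \<le> C * (h ^ mlen \<alpha> * (N (mlen \<alpha>) / fact (mlen \<alpha>)))"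
  shows "lam_norm N h b \<le> C"
  unfolding lam_norm_def
proof (rule cSUP_least)
  fix \<alpha> :: "'n \<Rightarrow> nat"
  have "h ^ mlen \<alpha> * (N (mlen \<alpha>) / fact (mlen \<alpha>)) > 0"
    using N h by (intro mult_pos_pos divide_pos_pos) auto
  then show "\<bar>b \<alpha>\<bar> / (h ^ mlen \<alpha> * (N (mlen \<alpha>) / fact (mlen \<alpha>))) \<le> C"
    using b[of \<alpha>] by (simp only: pos_divide_le_eq)
qed simp

lemma Lam_beur_linear_combination:
  fixes x y :: "('n::finite \<Rightarrow> nat) \<Rightarrow> real"
  assumes N: "\<And>p. N p > 0" and "x \<in> Lam_beur N" "y \<in> Lam_beur N"
  shows "(\<lambda>\<alpha>. c * x \<alpha> + d * y \<alpha>) \<in> Lam_beur N"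
  unfolding Lam_beur_def
proof (intro CollectI allI impI)
  fix h :: real assume h: "h > 0"
  define w where "w = (\<lambda>\<alpha>::'n \<Rightarrow> nat. h ^ mlen \<alpha> * (N (mlen \<alpha>) / fact (mlen \<alpha>)))"
  have "lam_bounded N h x" "lam_bounded N h y" using assms h by (auto simp: Lam_beur_def)
  then obtain C D where C: "\<And>\<alpha>. \<bar>x \<alpha>\<bar> \<le> C * w \<alpha>" and D: "\<And>\<alpha>. \<bar>y \<alpha>\<bar> \<le> D * w \<alpha>"
    unfolding lam_bounded_iff[OF N h] w_def by blast
  have "\<bar>c * x \<alpha> + d * y \<alpha>\<bar> \<le> (\<bar>c\<bar> * C + \<bar>d\<bar> * D) * w \<alpha>" for \<alpha>
  proof -
    have "\<bar>c * x \<alpha> + d * y \<alpha>\<bar> \<le> \<bar>c\<bar> * \<bar>x \<alpha>\<bar> + \<bar>d\<bar> * \<bar>y \<alpha>\<bar>"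
      using abs_triangle_ineq[of "c * x \<alpha>" "d * y \<alpha>"] by (simp add: abs_mult)
    also have "\<dots> \<le> \<bar>c\<bar> * (C * w \<alpha>) + \<bar>d\<bar> * (D * w \<alpha>)"
      using C D by (intro add_mono mult_left_mono) auto
    finally show ?thesis by (simp add: algebra_simps)
  qed
  then show "lam_bounded N h (\<lambda>\<alpha>. c * x \<alpha> + d * y \<alpha>)"
    unfolding lam_bounded_iff[OF N h] w_def by blast
qed

text \<open>The constructor \<open>topology\<close> returns the intended open sets only once the
  axioms are checked. For intersections, unite the two finite families of seminorms and take the
  smaller radius.\<close>

lemma openin_lam_top:
  fixes S :: "(('n::finite \<Rightarrow> nat) \<Rightarrow> real) set"
  shows "openin (lam_top N) S \<longleftrightarrow> S \<subseteq> Lam_beur N \<and> (\<forall>x\<in>S. \<exists>hs. finite hs \<and> (\<forall>h\<in>hs. h > 0) \<and>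
      (\<exists>e>0. {y \<in> Lam_beur N. \<forall>h\<in>hs. lam_norm N h (\<lambda>\<alpha>. y \<alpha> - x \<alpha>) < e} \<subseteq> S))"
proof -
  define nbhd :: "(('n \<Rightarrow> nat) \<Rightarrow> real) \<Rightarrow> real set \<Rightarrow> real \<Rightarrow> (('n \<Rightarrow> nat) \<Rightarrow> real) set"
    where "nbhd = (\<lambda>x hs e. {y \<in> Lam_beur N. \<forall>h\<in>hs. lam_norm N h (\<lambda>\<alpha>. y \<alpha> - x \<alpha>) < e})"
  have "istopology (\<lambda>S. S \<subseteq> Lam_beur N \<and> (\<forall>x\<in>S. \<exists>hs. finite hs \<and> (\<forall>h\<in>hs. h > 0) \<and>
      (\<exists>e>0. nbhd x hs e \<subseteq> S)))"
    unfolding istopology_def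
  proof (intro conjI allI impI)
    fix S T
    assume S: "S \<subseteq> Lam_beur N \<and> (\<forall>x\<in>S. \<exists>hs. finite hs \<and> (\<forall>h\<in>hs. h > 0) \<and> (\<exists>e>0. nbhd x hs e \<subseteq> S))"
      and T: "T \<subseteq> Lam_beur N \<and> (\<forall>x\<in>T. \<exists>hs. finite hs \<and> (\<forall>h\<in>hs. h > 0) \<and> (\<exists>e>0. nbhd x hs e \<subseteq> T))"
    show "S \<inter> T \<subseteq> Lam_beur N" using S by blast
    show "\<forall>x\<in>S \<inter> T. \<exists>hs. finite hs \<and> (\<forall>h\<in>hs. h > 0) \<and> (\<exists>e>0. nbhd x hs e \<subseteq> S \<inter> T)"
    proof
      fix x assume "x \<in> S \<inter> T"
      then obtain hs e hs' e' where "finite hs" "\<forall>h\<in>hs. h > 0" "e > 0" "nbhd x hs e \<subseteq> S"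
        "finite hs'" "\<forall>h\<in>hs'. h > 0" "e' > 0" "nbhd x hs' e' \<subseteq> T"
        using S T by (metis IntD1 IntD2)
      moreover have "nbhd x (hs \<union> hs') (min e e') \<subseteq> nbhd x hs e \<inter> nbhd x hs' e'"
        by (auto simp: nbhd_def)
      ultimately show "\<exists>hs. finite hs \<and> (\<forall>h\<in>hs. h > 0) \<and> (\<exists>e>0. nbhd x hs e \<subseteq> S \<inter> T)"
        by (intro exI[of _ "hs \<union> hs'"] conjI exI[of _ "min e e'"]) auto
    qed
  next
    fix \<K>
    assume \<K>: "\<forall>S\<in>\<K>. S \<subseteq> Lam_beur N \<and>
      (\<forall>x\<in>S. \<exists>hs. finite hs \<and> (\<forall>h\<in>hs. h > 0) \<and> (\<exists>e>0. nbhd x hs e \<subseteq> S))"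
    show "\<Union>\<K> \<subseteq> Lam_beur N" using \<K> by blast
    show "\<forall>x\<in>\<Union>\<K>. \<exists>hs. finite hs \<and> (\<forall>h\<in>hs. h > 0) \<and> (\<exists>e>0. nbhd x hs e \<subseteq> \<Union>\<K>)"
      using \<K> by (meson UnionE Union_upper order_trans)
  qed
  then show ?thesis
    unfolding lam_top_def nbhd_def by (simp only: topology_inverse')
qed

lemma topspace_lam_top: "topspace (lam_top N) = Lam_beur N"
proof (rule antisym)
  show "topspace (lam_top N) \<subseteq> Lam_beur N"
    using openin_topspace[of "lam_top N"] unfolding openin_lam_top by blast
  have "openin (lam_top N) (Lam_beur N)"
    unfolding openin_lam_top by (auto intro!: exI[of _ "{}"] exI[of _ "1::real"])
  then show "Lam_beur N \<subseteq> topspace (lam_top N)" by (rule openin_subset)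
qed

text \<open>The single seminorm with \<open>h = 1\<close> already controls each coefficient, up to
  the factor \<open>N (mlen \<alpha>) / fact (mlen \<alpha>)\<close>.\<close>

lemma continuous_map_coefficient:
  fixes \<alpha> :: "'n::finite \<Rightarrow> nat"
  assumes N: "\<And>p. N p > 0"
  shows "continuous_map (lam_top N) euclideanreal (\<lambda>y. y \<alpha>)"
  unfolding continuous_map_def topspace_lam_top
proof (intro conjI allI impI)
  fix U :: "real set" assume "openin euclideanreal U"
  then have U: "open U" by simp
  show "openin (lam_top N) {y \<in> Lam_beur N. y \<alpha> \<in> U}"
    unfolding openin_lam_top
  proof (intro conjI ballI)
    fix x assume "x \<in> {y \<in> Lam_beur N. y \<alpha> \<in> U}"
    then have x: "x \<in> Lam_beur N" "x \<alpha> \<in> U" by auto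
    then obtain e where e: "e > 0" "ball (x \<alpha>) e \<subseteq> U" using U open_contains_ball by blast
    define n where "n = N (mlen \<alpha>) / fact (mlen \<alpha>)"
    have n: "n > 0" using N by (simp add: n_def)
    have "y \<alpha> \<in> U" if y: "y \<in> Lam_beur N" "lam_norm N 1 (\<lambda>\<alpha>. y \<alpha> - x \<alpha>) < e / n" for y
    proof -
      have "(\<lambda>\<alpha>. y \<alpha> - x \<alpha>) \<in> Lam_beur N"
        using Lam_beur_linear_combination[OF N y(1) x(1), of 1 "-1"] by simp
      then have "lam_bounded N 1 (\<lambda>\<alpha>. y \<alpha> - x \<alpha>)" by (simp add: Lam_beur_def)
      from abs_le_lam_norm[OF N _ this, of \<alpha>]
      have "\<bar>y \<alpha> - x \<alpha>\<bar> \<le> lam_norm N 1 (\<lambda>\<alpha>. y \<alpha> - x \<alpha>) * n" by (simp add: n_def)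
      also have "\<dots> < e" using y(2) n by (simp add: pos_less_divide_eq)
      finally show ?thesis using e(2) by (auto simp: dist_real_def abs_minus_commute)
    qed
    then show "\<exists>hs. finite hs \<and> (\<forall>h\<in>hs. h > 0) \<and> (\<exists>e>0.
        {y \<in> Lam_beur N. \<forall>h\<in>hs. lam_norm N h (\<lambda>\<alpha>. y \<alpha> - x \<alpha>) < e} \<subseteq> {y \<in> Lam_beur N. y \<alpha> \<in> U})"
      using e(1) n by (intro exI[of _ "{1}"] conjI exI[of _ "e / n"]) auto
  qed auto
qed auto

lemma continuous_map_line:
  fixes b :: "('n::finite \<Rightarrow> nat) \<Rightarrow> real"
  assumes N: "\<And>p. N p > 0" and b: "b \<in> Lam_beur N"
  shows "continuous_map euclideanreal (lam_top N) (\<lambda>t \<alpha>. t * b \<alpha>)"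
  unfolding continuous_map_def topspace_lam_top
proof (intro conjI allI impI)
  have line: "(\<lambda>\<alpha>. t * b \<alpha>) \<in> Lam_beur N" for t
    using Lam_beur_linear_combination[OF N b b, of t 0] by simp
  then show "(\<lambda>t \<alpha>. t * b \<alpha>) \<in> topspace euclideanreal \<rightarrow> Lam_beur N" by simp
  fix U :: "(('n \<Rightarrow> nat) \<Rightarrow> real) set" assume U: "openin (lam_top N) U"
  have "open {t. (\<lambda>\<alpha>. t * b \<alpha>) \<in> U}"
    unfolding open_dist
  proof (intro ballI)
    fix t assume "t \<in> {t. (\<lambda>\<alpha>. t * b \<alpha>) \<in> U}"
    then obtain hs e where hs: "finite hs" "\<forall>h\<in>hs. h > 0" and e: "e > 0"
      and sub: "{y \<in> Lam_beur N. \<forall>h\<in>hs. lam_norm N h (\<lambda>\<alpha>. y \<alpha> - t * b \<alpha>) < e} \<subseteq> U"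
      using U unfolding openin_lam_top by fastforce
    \<comment> \<open>A common bound for the finitely many seminorms of \<open>b\<close>. The
      summand 1 keeps it positive, so that \<open>e / (2 * R)\<close> is a legitimate
      radius.\<close>
    define R where "R = 1 + (\<Sum>h\<in>hs. \<bar>lam_norm N h b\<bar>)"
    have R: "R > 0" unfolding R_def by (intro add_pos_nonneg sum_nonneg) auto
    have norm_R: "lam_norm N h b \<le> R" if "h \<in> hs" for h
      using member_le_sum[OF that, of "\<lambda>h. \<bar>lam_norm N h b\<bar>"] hs(1) by (simp add: R_def)
    have "(\<lambda>\<alpha>. s * b \<alpha>) \<in> U" if s: "dist s t < e / (2 * R)" for s
    proof -
      have "lam_norm N h (\<lambda>\<alpha>. s * b \<alpha> - t * b \<alpha>) < e" if h: "h \<in> hs" for h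
      proof -
        have h0: "h > 0" and bb: "lam_bounded N h b" using h hs b by (auto simp: Lam_beur_def)
        have "lam_norm N h (\<lambda>\<alpha>. s * b \<alpha> - t * b \<alpha>) \<le> \<bar>s - t\<bar> * R"
        proof (rule lam_norm_le[OF N h0])
          fix \<alpha> :: "'n \<Rightarrow> nat"
          have w: "h ^ mlen \<alpha> * (N (mlen \<alpha>) / fact (mlen \<alpha>)) \<ge> 0"
            using N h0 by (intro mult_nonneg_nonneg divide_nonneg_nonneg) (auto intro: less_imp_le)
          have "\<bar>s * b \<alpha> - t * b \<alpha>\<bar> = \<bar>s - t\<bar> * \<bar>b \<alpha>\<bar>"
            by (simp add: abs_mult[symmetric] left_diff_distrib)
          also have "\<dots> \<le> \<bar>s - t\<bar> * (R * (h ^ mlen \<alpha> * (N (mlen \<alpha>) / fact (mlen \<alpha>))))"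
            using abs_le_lam_norm[OF N h0 bb, of \<alpha>] mult_right_mono[OF norm_R[OF h] w]
            by (intro mult_left_mono) auto
          finally show "\<bar>s * b \<alpha> - t * b \<alpha>\<bar>
              \<le> \<bar>s - t\<bar> * R * (h ^ mlen \<alpha> * (N (mlen \<alpha>) / fact (mlen \<alpha>)))"
            by (simp only: mult.assoc)
        qed
        also have "\<dots> < e" using s R e by (simp add: dist_real_def field_simps)
        finally show ?thesis .
      qed
      then show ?thesis using sub line by blast
    qed
    then show "\<exists>e>0. \<forall>s. dist s t < e \<longrightarrow> s \<in> {t. (\<lambda>\<alpha>. t * b \<alpha>) \<in> U}"
      using e R by (intro exI[of _ "e / (2 * R)"]) auto
  qed
  then show "openin euclideanreal {t \<in> topspace euclideanreal. (\<lambda>\<alpha>. t * b \<alpha>) \<in> U}" by simp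
qed

text \<open>Coefficients separate points. This is what makes the compact support of the witness
  measure closed, hence Borel.\<close>

lemma Hausdorff_space_lam_top:
  assumes N: "\<And>p. N p > 0"
  shows "Hausdorff_space (lam_top N :: (('n::finite \<Rightarrow> nat) \<Rightarrow> real) topology)"
  unfolding Hausdorff_space_def topspace_lam_top
proof (intro allI impI)
  fix x y :: "('n \<Rightarrow> nat) \<Rightarrow> real"
  assume xy: "x \<in> Lam_beur N \<and> y \<in> Lam_beur N \<and> x \<noteq> y"
  then obtain \<alpha> where "x \<alpha> \<noteq> y \<alpha>" by blast
  then obtain U V where "open U" "open V" "x \<alpha> \<in> U" "y \<alpha> \<in> V" "U \<inter> V = {}"
    by (meson hausdorff)
  moreover have "openin (lam_top N) {z \<in> Lam_beur N. z \<alpha> \<in> W}" if "open W" for W :: "real set"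
    using openin_continuous_map_preimage[OF continuous_map_coefficient[where \<alpha> = \<alpha>, OF N]] that
    by (simp add: topspace_lam_top)
  ultimately show "\<exists>U V. openin (lam_top N) U \<and> openin (lam_top N) V \<and> x \<in> U \<and> y \<in> V \<and> disjnt U V"
    using xy by (intro exI[of _ "{z \<in> Lam_beur N. z \<alpha> \<in> U}"] exI[of _ "{z \<in> Lam_beur N. z \<alpha> \<in> V}"])
      (auto simp: disjnt_def)
qed

section \<open>Borel sets and a criterion for Haar-null sets\<close>

lemma space_lam_borel: "space (lam_borel N) = Lam_beur N"
  and sets_lam_borel: "sets (lam_borel N) = sigma_sets (Lam_beur N) {S. openin (lam_top N) S}"
  by (auto simp: lam_borel_def openin_lam_top intro!: space_measure_of sets_measure_of)

lemma closedin_in_sets_lam_borel: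
  assumes "closedin (lam_top N) C"
  shows "C \<in> sets (lam_borel N)"
proof -
  have "Lam_beur N - C \<in> sets (lam_borel N)"
    using assms by (auto simp: closedin_def topspace_lam_top sets_lam_borel)
  then have "space (lam_borel N) - (Lam_beur N - C) \<in> sets (lam_borel N)" by blast
  moreover have "space (lam_borel N) - (Lam_beur N - C) = C"
    using assms by (auto simp: closedin_def topspace_lam_top space_lam_borel)
  ultimately show ?thesis by simp
qed

text \<open>Exchanging \<open>s\<close> and \<open>t\<close> in \<open>once\<close> gives
  \<open>s = t\<close>, so a line in direction \<open>b\<close> meets a translate of each
  \<open>C m\<close> at most once and a translate of the union in countably many points. The uniform
  distribution on a segment of the line ignores countable sets.\<close>

lemma haar_null_borel_UN_closed:
  fixes b :: "('n::finite \<Rightarrow> nat) \<Rightarrow> real" and C :: "nat \<Rightarrow> (('n \<Rightarrow> nat) \<Rightarrow> real) set"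
  assumes N: "\<And>p. N p > 0" and b: "b \<in> Lam_beur N"
    and closed: "\<And>m. closedin (lam_top N) (C m)"
    and once: "\<And>m x s t. \<lbrakk>(\<lambda>\<alpha>. s * b \<alpha> - x \<alpha>) \<in> C m; (\<lambda>\<alpha>. t * b \<alpha> - x \<alpha>) \<in> C m\<rbrakk> \<Longrightarrow> s \<le> t"
  shows "haar_null_borel N (\<Union>m. C m)"
proof -
  define line where "line = (\<lambda>t \<alpha>. t * b \<alpha>)"
  have cont: "continuous_map euclideanreal (lam_top N) line"
    unfolding line_def by (rule continuous_map_line[OF N b])
  define \<nu> where "\<nu> = uniform_measure lborel {0..1::real}"
  have \<nu>: "prob_space \<nu>" unfolding \<nu>_def by (intro prob_space_uniform_measure) auto
  have meas: "line \<in> measurable \<nu> (lam_borel N)"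
    unfolding lam_borel_def
  proof (rule measurable_measure_of)
    show "{S. openin (lam_top N) S} \<subseteq> Pow (Lam_beur N)" by (auto simp: openin_lam_top)
    show "line \<in> space \<nu> \<rightarrow> Lam_beur N"
      using continuous_map_funspace[OF cont] by (auto simp: topspace_lam_top)
    fix S :: "(('n \<Rightarrow> nat) \<Rightarrow> real) set" assume "S \<in> {S. openin (lam_top N) S}"
    then have "open (line -` S)"
      using openin_continuous_map_preimage[OF cont, of S] by (simp add: vimage_def)
    then show "line -` S \<inter> space \<nu> \<in> sets \<nu>" by (simp add: \<nu>_def)
  qed
  define \<mu> where "\<mu> = distr \<nu> (lam_borel N) line"
  define K where "K = line ` {0..1}"
  have K: "compactin (lam_top N) K"
    unfolding K_def by (rule image_compactin[OF _ cont]) simp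
  then have K_sets: "K \<in> sets (lam_borel N)"
    by (intro closedin_in_sets_lam_borel compactin_imp_closedin Hausdorff_space_lam_top N)
  have "emeasure \<mu> K = emeasure \<nu> (line -` K \<inter> space \<nu>)"
    unfolding \<mu>_def by (rule emeasure_distr[OF meas K_sets])
  also have "\<dots> = 1"
  proof -
    have "line -` K \<inter> space \<nu> \<in> sets lborel"
      using measurable_sets[OF meas K_sets] by (simp add: \<nu>_def)
    then have "emeasure \<nu> (line -` K \<inter> space \<nu>)
        = emeasure lborel ({0..1} \<inter> (line -` K \<inter> space \<nu>)) / emeasure lborel {0..1::real}"
      unfolding \<nu>_def by (intro emeasure_uniform_measure) auto
    moreover have "{0..1} \<inter> (line -` K \<inter> space \<nu>) = {0..1}"
      by (auto simp: K_def \<nu>_def)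
    ultimately show ?thesis by simp
  qed
  finally have K_full: "emeasure \<mu> K = 1" .
  have null: "emeasure \<mu> ((\<lambda>y \<alpha>. x \<alpha> + y \<alpha>) ` (\<Union>m. C m)) = 0" (is "emeasure \<mu> ?X = 0") for x
  proof (cases "?X \<in> sets (lam_borel N)")
    \<comment> \<open>Translates are not shown to be Borel; on a non-measurable set
      \<open>emeasure\<close> takes the default value 0.\<close>
    case False
    then show ?thesis by (intro emeasure_notin_sets) (simp add: \<mu>_def)
  next
    case True
    define D where "D = (\<lambda>m. {t. (\<lambda>\<alpha>. t * b \<alpha> - x \<alpha>) \<in> C m})"
    have "countable (D m)" for m
    proof -
      have "s = t" if "s \<in> D m" "t \<in> D m" for s t
        using that once[of s x m t] once[of t x m s] by (auto simp: D_def)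
      then have "D m = {} \<or> (\<exists>t. D m = {t})" by blast
      then show ?thesis by auto
    qed
    then have "countable (\<Union>m. D m)" by blast
    moreover have sub: "line -` ?X \<inter> space \<nu> \<subseteq> (\<Union>m. D m)"
    proof
      fix t assume "t \<in> line -` ?X \<inter> space \<nu>"
      then obtain y m where "line t = (\<lambda>\<alpha>. x \<alpha> + y \<alpha>)" "y \<in> C m" by auto
      moreover from this(1) have "y = (\<lambda>\<alpha>. t * b \<alpha> - x \<alpha>)"
        by (auto simp: line_def fun_eq_iff)
      ultimately show "t \<in> (\<Union>m. D m)" by (auto simp: D_def)
    qed
    ultimately have count: "countable (line -` ?X \<inter> space \<nu>)" by (rule countable_subset[rotated])
    have "emeasure \<mu> ?X = emeasure \<nu> (line -` ?X \<inter> space \<nu>)"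
      unfolding \<mu>_def by (rule emeasure_distr[OF meas True])
    also have "\<dots> = emeasure lborel ({0..1} \<inter> (line -` ?X \<inter> space \<nu>)) / emeasure lborel {0..1::real}"
      unfolding \<nu>_def using measurable_sets[OF meas True]
      by (intro emeasure_uniform_measure) (auto simp: \<nu>_def)
    also have "emeasure lborel ({0..1} \<inter> (line -` ?X \<inter> space \<nu>)) = 0"
      using count by (intro emeasure_lborel_countable) (rule countable_Int2)
    finally show ?thesis by simp
  qed
  have "prob_space \<mu>" unfolding \<mu>_def by (rule prob_space.prob_space_distr[OF \<nu> meas])
  moreover have "(\<Union>m. C m) \<in> sets (lam_borel N)"
    using closed closedin_in_sets_lam_borel by (intro sets.countable_UN) blast
  moreover have "sets \<mu> = sets (lam_borel N)" "space \<mu> = Lam_beur N"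
    by (simp_all add: \<mu>_def space_lam_borel)
  ultimately show ?thesis
    unfolding haar_null_borel_def using K K_sets K_full null
    by (intro conjI exI[of _ \<mu>] exI[of _ K]) auto
qed

section \<open>Restriction of jets to a coordinate axis\<close>

lemma mlen_single: "mlen ((\<lambda>_. 0)(e := j)) = j" for e :: "'n::finite"
  by (simp add: mlen_def fun_upd_def)

text \<open>For a multi-index supported on one coordinate only one list has the prescribed counts,
  so the choice made in \<open>dpow\<close> is determined and no symmetry of partial derivatives is
  required.\<close>

lemma dpow_single: "dpow ((\<lambda>_. 0)(e := j)) f = iter_partial (replicate j e) f"
proof -
  have count: "count_list (replicate k e) i = ((\<lambda>_. 0)(e := k)) i" for i k
    by (induction k) auto
  have "(SOME ds. \<forall>i. count_list ds i = ((\<lambda>_. 0)(e := j)) i) = replicate j e"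
  proof (rule some_equality)
    show "\<forall>i. count_list (replicate j e) i = ((\<lambda>_. 0)(e := j)) i" using count by blast
  next
    fix ds assume ds: "\<forall>i. count_list ds i = ((\<lambda>_. 0)(e := j)) i"
    have "i = e" if "i \<in> set ds" for i
      using ds that by (metis count_list_0_iff fun_upd_other)
    then have "ds = replicate (length ds) e" by (metis replicate_length_same)
    moreover from this have "length ds = j"
      using ds count by (metis fun_upd_same)
    ultimately show "ds = replicate j e" by simp
  qed
  then show ?thesis by (simp add: dpow_def)
qed

text \<open>A single natural number \<open>m\<close> fixes the length of the interval and both
  constants of the Roumieu estimate, so that countably many sets exhaust all germs. Coefficients off
  the axis of \<open>e\<close> are left free.\<close>

definition axis_jets :: "(nat \<Rightarrow> real) \<Rightarrow> 'n::finite \<Rightarrow> nat \<Rightarrow> (('n \<Rightarrow> nat) \<Rightarrow> real) set" where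
  "axis_jets M e m = {y. \<exists>F. deriv_tower (1 / real (Suc m)) (\<lambda>j. real (Suc m) ^ Suc j * M j) F \<and>
      (\<forall>j. y ((\<lambda>_. 0)(e := j)) = F j 0 / fact j)}"

lemma jet_germ_roum_subset_axis_jets:
  fixes e :: "'n::finite"
  assumes M: "\<And>p. M p > 0"
  shows "jet_germ_roum M \<subseteq> (\<Union>m. axis_jets M e m)"
proof
  fix y :: "('n \<Rightarrow> nat) \<Rightarrow> real" assume "y \<in> jet_germ_roum M"
  then obtain f k where y: "y = jet f" and k: "k \<ge> 1" and f: "f \<in> E_roum M (cube k)"
    by (auto simp: jet_germ_roum_def)
  \<comment> \<open>Half the side of the cube, so that the closed segment lies inside the open
    cube.\<close>
  define K :: "(real^'n) set" where "K = (\<lambda>t. t *\<^sub>R axis e 1) ` {0..1 / (2 * real k)}"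
  have "compact K" unfolding K_def by (intro compact_continuous_image continuous_intros) auto
  moreover have K_cube: "K \<subseteq> cube k"
  proof
    fix x assume "x \<in> K"
    then obtain t where t: "x = t *\<^sub>R axis e 1" "0 \<le> t" "t \<le> 1 / (2 * real k)" by (auto simp: K_def)
    have "1 / (2 * real k) < 1 / real k" using k by (simp add: field_simps)
    then have "\<bar>t\<bar> < 1 / real k" using t by linarith
    then show "x \<in> cube k" using k by (auto simp: cube_def t(1) axis_def)
  qed
  ultimately have "\<exists>h>0. \<exists>C. \<forall>\<alpha>. \<forall>x\<in>K. \<bar>dpow \<alpha> f x\<bar> \<le> C * h ^ mlen \<alpha> * M (mlen \<alpha>)"
    using f unfolding E_roum_def by simp
  then obtain h C where h: "h > 0"
    and bound: "\<And>\<alpha> x. x \<in> K \<Longrightarrow> \<bar>dpow \<alpha> f x\<bar> \<le> C * h ^ mlen \<alpha> * M (mlen \<alpha>)"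
    by blast
  obtain m where "max (2 * real k) (max C h) \<le> real m" using real_arch_simple by blast
  then have m: "2 * real k \<le> real (Suc m)" "C \<le> real (Suc m)" "h \<le> real (Suc m)" by auto
  define F where "F = (\<lambda>j t. iter_partial (replicate j e) f (t *\<^sub>R axis e 1))"
  have "deriv_tower (1 / real (Suc m)) (\<lambda>j. real (Suc m) ^ Suc j * M j) F"
    unfolding deriv_tower_def
  proof (intro allI ballI conjI)
    fix j t assume t: "t \<in> {0..1 / real (Suc m)}"
    have "1 / real (Suc m) \<le> 1 / (2 * real k)" using m k by (intro divide_left_mono) auto
    then have K: "t *\<^sub>R axis e 1 \<in> K" using t by (auto simp: K_def)
    define g where "g = iter_partial (replicate j e) f"
    have "(\<lambda>s. g (t *\<^sub>R axis e 1 + s *\<^sub>R axis e 1)) differentiable (at 0)"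
      using f K K_cube unfolding E_roum_def smooth_on_def g_def by blast
    then have "((\<lambda>s. g (t *\<^sub>R axis e 1 + s *\<^sub>R axis e 1)) has_real_derivative
        partial e g (t *\<^sub>R axis e 1)) (at 0)"
      unfolding partial_def using DERIV_deriv_iff_real_differentiable by blast
    then have "((\<lambda>s. g ((s + t) *\<^sub>R axis e 1)) has_real_derivative
        partial e g (t *\<^sub>R axis e 1)) (at 0)"
      by (simp add: scaleR_add_left add.commute)
    then have "((\<lambda>s. g (s *\<^sub>R axis e 1)) has_real_derivative
        partial e g (t *\<^sub>R axis e 1)) (at t)"
      using DERIV_shift[of "\<lambda>s. g (s *\<^sub>R axis e 1)" _ 0 t] by simp
    then show "(F j has_real_derivative F (Suc j) t) (at t)"
      by (simp add: F_def g_def)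
    have "\<bar>F j t\<bar> \<le> C * h ^ j * M j"
      using bound[OF K, of "(\<lambda>_. 0)(e := j)"] by (simp add: F_def dpow_single mlen_single)
    \<comment> \<open>One factor \<open>Suc m\<close> absorbs \<open>C\<close>, the remaining
      \<open>j\<close> factors absorb \<open>h ^ j\<close>.\<close>
    also have "\<dots> \<le> real (Suc m) * real (Suc m) ^ j * M j"
      using m h M[of j] by (intro mult_right_mono mult_mono power_mono) auto
    finally show "\<bar>F j t\<bar> \<le> real (Suc m) ^ Suc j * M j" by simp
  qed
  moreover have "y ((\<lambda>_. 0)(e := j)) = F j 0 / fact j" for j
    by (simp add: y jet_def F_def dpow_single mlen_single)
  ultimately have "y \<in> axis_jets M e m" by (auto simp: axis_jets_def)
  then show "y \<in> (\<Union>m. axis_jets M e m)" by blast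
qed

section \<open>Stability of the coefficient bound under closure\<close>

lemma closure_of_lam_top_approx:
  fixes y :: "('n::finite \<Rightarrow> nat) \<Rightarrow> real"
  assumes N: "\<And>p. N p > 0" and y: "y \<in> lam_top N closure_of A" and J: "finite J" and d: "d > 0"
  shows "\<exists>z\<in>A. \<forall>\<alpha>\<in>J. \<bar>z \<alpha> - y \<alpha>\<bar> < d"
proof -
  have yL: "y \<in> Lam_beur N" using y by (auto simp: in_closure_of topspace_lam_top)
  \<comment> \<open>Intersecting with the whole space keeps the set open when \<open>J\<close> is
    empty and the inner intersection is everything.\<close>
  have "openin (lam_top N) (topspace (lam_top N) \<inter> (\<Inter>\<alpha>\<in>J. {z \<in> Lam_beur N. z \<alpha> \<in> ball (y \<alpha>) d}))"
  proof (cases "J = {}")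
    case False
    then show ?thesis
    proof (intro openin_Int openin_topspace openin_INT2 J)
      fix \<alpha>
      show "openin (lam_top N) {z \<in> Lam_beur N. z \<alpha> \<in> ball (y \<alpha>) d}"
        using openin_continuous_map_preimage[OF continuous_map_coefficient[where \<alpha> = \<alpha>, OF N],
            of "ball (y \<alpha>) d"]
        by (simp only: topspace_lam_top open_openin[symmetric] open_ball)
    qed
  qed simp
  moreover have "y \<in> topspace (lam_top N) \<inter> (\<Inter>\<alpha>\<in>J. {z \<in> Lam_beur N. z \<alpha> \<in> ball (y \<alpha>) d})"
    using yL d by (auto simp: topspace_lam_top)
  ultimately obtain z where "z \<in> A" "z \<in> (\<Inter>\<alpha>\<in>J. {z \<in> Lam_beur N. z \<alpha> \<in> ball (y \<alpha>) d})"
    using y unfolding in_closure_of by blast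
  then show ?thesis by (auto simp: dist_real_def abs_minus_commute intro!: bexI[of _ z])
qed

text \<open>Points of the closure need not come from functions, but the coefficient bound asks for
  positivity at finitely many orders only. It is therefore applied to the difference of two nearby
  genuine jets, which costs the factor 1/2.\<close>

lemma axis_jets_closure_difference_bound:
  fixes e :: "'n::finite" and p q :: "('n \<Rightarrow> nat) \<Rightarrow> real"
  assumes N: "\<And>p. N p > 0" and M: "log_convex_seq M" and quasi: "\<not> summable (\<lambda>p. M p / M (Suc p))"
    and p: "p \<in> lam_top N closure_of (Lam_beur N \<inter> axis_jets M e m)"
    and q: "q \<in> lam_top N closure_of (Lam_beur N \<inter> axis_jets M e m)"
    and c: "\<And>j. c j = p ((\<lambda>_. 0)(e := j)) - q ((\<lambda>_. 0)(e := j))" and c_pos: "\<And>j. c j > 0"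
  shows "c j / 2 * (1 / real (Suc m)) ^ j \<le> 2 * (real (Suc m) * M 0) + 1"
proof -
  define a where "a = 1 / real (Suc m)"
  define L where "L = (\<lambda>j. real (Suc m) ^ Suc j * M j)"
  define L' where "L' = (\<lambda>j. 2 * L j)"
  have L': "log_convex_seq L'"
    unfolding log_convex_seq_def
  proof (intro conjI allI)
    fix i
    show "L' i > 0" using M by (simp add: L'_def L_def log_convex_seq_def)
    have "(M (Suc i))\<^sup>2 \<le> M i * M (Suc (Suc i))" using M by (simp add: log_convex_seq_def)
    then have "(2 * real (Suc m) ^ Suc (Suc i))\<^sup>2 * (M (Suc i))\<^sup>2
        \<le> (2 * real (Suc m) ^ Suc (Suc i))\<^sup>2 * (M i * M (Suc (Suc i)))"
      by (intro mult_left_mono) auto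
    then show "(L' (Suc i))\<^sup>2 \<le> L' i * L' (Suc (Suc i))"
      by (simp add: L'_def L_def power2_eq_square mult_ac)
  qed
  \<comment> \<open>Rescaling multiplies all ratios by the same positive constant, so divergence of
    their sum is inherited from \<open>M\<close>.\<close>
  have ratio: "L' i / L' (Suc i) = inverse (real (Suc m)) * (M i / M (Suc i))" for i
    by (simp add: L'_def L_def divide_simps)
  have "\<not> summable (\<lambda>i. L' i / L' (Suc i))"
    unfolding ratio summable_cmult_iff using quasi by simp
  then obtain n where n: "\<And>F. deriv_tower a L' F \<Longrightarrow> (\<forall>i\<le>n. F i 0 \<ge> 0)
      \<Longrightarrow> F j 0 / fact j * a ^ j \<le> L' 0 + 1"
    using deriv_tower_coefficient_bound[OF L', of a j] by (auto simp: a_def)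
  define J where "J = {..max n j}"
  \<comment> \<open>Each of the two approximations is off by less than a quarter of every relevant
    \<open>c i\<close>, so their difference retains at least \<open>c i / 2\<close>.\<close>
  define d where "d = Min (c ` J) / 4"
  have fin: "finite (c ` J)" "c ` J \<noteq> {}" by (auto simp: J_def)
  have d: "d > 0" using Min_in[OF fin] c_pos by (auto simp: d_def)
  have d_le: "4 * d \<le> c i" if "i \<in> J" for i
    using Min_le[OF fin(1)] that by (simp add: d_def)
  define I where "I = (\<lambda>i. (\<lambda>_. 0)(e := i)) ` J"
  have "finite I" by (simp add: I_def J_def)
  then obtain p' q' where p': "p' \<in> axis_jets M e m" "\<And>\<alpha>. \<alpha> \<in> I \<Longrightarrow> \<bar>p' \<alpha> - p \<alpha>\<bar> < d"
    and q': "q' \<in> axis_jets M e m" "\<And>\<alpha>. \<alpha> \<in> I \<Longrightarrow> \<bar>q' \<alpha> - q \<alpha>\<bar> < d"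
    using closure_of_lam_top_approx[OF N p _ d] closure_of_lam_top_approx[OF N q _ d] by (meson IntD2)
  obtain F G where F: "deriv_tower a L F" "\<And>i. p' ((\<lambda>_. 0)(e := i)) = F i 0 / fact i"
    and G: "deriv_tower a L G" "\<And>i. q' ((\<lambda>_. 0)(e := i)) = G i 0 / fact i"
    using p'(1) q'(1) unfolding axis_jets_def a_def L_def by blast
  have approx: "(F i 0 - G i 0) / fact i \<ge> c i / 2" if i: "i \<in> J" for i
  proof -
    have "(\<lambda>_. 0)(e := i) \<in> I" using i by (simp add: I_def)
    from p'(2)[OF this] q'(2)[OF this] show ?thesis
      using d_le[OF i] by (simp add: F(2) G(2) c diff_divide_distrib)
  qed
  have "F i 0 - G i 0 \<ge> 0" if "i \<le> n" for i
  proof -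
    have "(F i 0 - G i 0) / fact i > 0"
      using that by (intro less_le_trans[OF _ approx[of i]]) (use c_pos[of i] in \<open>auto simp: J_def\<close>)
    then show ?thesis by (simp add: zero_less_divide_iff)
  qed
  then have "(F j 0 - G j 0) / fact j * a ^ j \<le> L' 0 + 1"
    using n[OF deriv_tower_diff[OF F(1) G(1), folded L'_def]] by blast
  moreover have "c j / 2 * a ^ j \<le> (F j 0 - G j 0) / fact j * a ^ j"
    using approx[of j] by (intro mult_right_mono) (auto simp: J_def a_def)
  ultimately have "c j / 2 * a ^ j \<le> L' 0 + 1" by (rule order_trans[rotated])
  then show ?thesis by (simp add: a_def L'_def L_def)
qed

section \<open>The direction \<open>b\<close> and the conclusion\<close>

lemma root_at_top_imp_eventually_power_le:
  fixes n :: "nat \<Rightarrow> real"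
  assumes lim: "filterlim (\<lambda>k. root k (n k)) at_top sequentially" and n: "\<And>k. n k > 0" and R: "R \<ge> 0"
  shows "eventually (\<lambda>k. R ^ k \<le> n k) sequentially"
proof -
  have "eventually (\<lambda>k. R \<le> root k (n k)) sequentially"
    using lim by (simp add: filterlim_at_top)
  then show ?thesis using eventually_gt_at_top[of 0]
  proof eventually_elim
    case (elim k)
    then have "R ^ k \<le> root k (n k) ^ k" using R by (intro power_mono)
    then show ?case using elim n[of k] by (simp add: less_imp_le)
  qed
qed

text \<open>With \<open>n k = N k / fact k\<close> the quotient to be bounded is
  \<open>1 / (h ^ k * sqrt (n k))\<close>, which is at most 1 once
  \<open>n k \<ge> (1 / h) ^ (2 * k)\<close>. The finitely many earlier indices are summed into the
  constant.\<close>

lemma sqrt_weight_in_Lam_beur: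
  assumes N: "\<And>p. N p > 0" and lim: "filterlim (\<lambda>k. root k (N k / fact k)) at_top sequentially"
  shows "(\<lambda>\<alpha>::'n::finite \<Rightarrow> nat. sqrt (N (mlen \<alpha>) / fact (mlen \<alpha>))) \<in> Lam_beur N"
  unfolding Lam_beur_def
proof (intro CollectI allI impI)
  fix h :: real assume h: "h > 0"
  define n where "n = (\<lambda>k. N k / fact k)"
  have n: "n k > 0" for k using N by (simp add: n_def)
  have "eventually (\<lambda>k. ((1 / h)\<^sup>2) ^ k \<le> n k) sequentially"
    using lim n by (intro root_at_top_imp_eventually_power_le) (auto simp: n_def)
  then obtain k0 where k0: "\<And>k. k \<ge> k0 \<Longrightarrow> ((1 / h)\<^sup>2) ^ k \<le> n k"
    by (auto simp: eventually_sequentially)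
  define C where "C = 1 + (\<Sum>k<k0. 1 / (h ^ k * sqrt (n k)))"
  have "1 / (h ^ k * sqrt (n k)) \<le> C" for k
  proof (cases "k < k0")
    case True
    have "1 / (h ^ k * sqrt (n k)) \<le> (\<Sum>k<k0. 1 / (h ^ k * sqrt (n k)))"
      using True h n by (intro member_le_sum) (auto simp: less_imp_le)
    then show ?thesis by (simp add: C_def)
  next
    case False
    have "(1 / h) ^ k = sqrt (((1 / h)\<^sup>2) ^ k)"
      using h by (simp add: real_sqrt_power)
    also have "\<dots> \<le> sqrt (n k)" using k0 False by simp
    finally have "1 \<le> h ^ k * sqrt (n k)" using h by (simp add: field_simps power_divide)
    then have "1 / (h ^ k * sqrt (n k)) \<le> 1" by simp
    moreover have "(\<Sum>k<k0. 1 / (h ^ k * sqrt (n k))) \<ge> 0"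
      using h n by (intro sum_nonneg) (auto simp: less_imp_le)
    ultimately show ?thesis by (simp add: C_def)
  qed
  moreover have "1 / (h ^ k * sqrt (n k)) = \<bar>sqrt (n k)\<bar> / (h ^ k * n k)" for k
    using n[of k] h real_sqrt_mult_self[of "n k"] by (simp add: field_simps)
  ultimately show "lam_bounded N h (\<lambda>\<alpha>::'n \<Rightarrow> nat. sqrt (N (mlen \<alpha>) / fact (mlen \<alpha>)))"
    unfolding lam_bounded_def n_def by (intro bdd_aboveI[of _ C]) auto
qed

theorem mainTheorem5:
  fixes M N :: "nat \<Rightarrow> real"
  assumes "weight_seq M" and "quasianalytic M"
    and "weight_seq N" and "quasianalytic N"
    and "filterlim (\<lambda>k. root k (N k / fact k)) at_top sequentially"
  shows "haar_null N ((jet_germ_roum M :: (('n::finite \<Rightarrow> nat) \<Rightarrow> real) set) \<inter> Lam_beur N)"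
proof -
  have N: "\<And>p. N p > 0" and M_pos: "\<And>p. M p > 0" using assms by (auto simp: weight_seq_def)
  have "(M (Suc p))\<^sup>2 \<le> M p * M (Suc (Suc p))" for p
    using assms(1) unfolding weight_seq_def by (metis Suc_eq_plus1 add_diff_cancel_right' le_add2)
  then have M: "log_convex_seq M" using M_pos by (simp add: log_convex_seq_def)
  have quasi: "\<not> summable (\<lambda>p. M p / M (Suc p))" using assms(2) by (simp add: quasianalytic_def)
  define n where "n = (\<lambda>k. N k / fact k)"
  have n: "n k > 0" for k using N by (simp add: n_def)
  define b where "b = (\<lambda>\<alpha>::'n \<Rightarrow> nat. sqrt (n (mlen \<alpha>)))"
  have b: "b \<in> Lam_beur N"
    unfolding b_def n_def by (rule sqrt_weight_in_Lam_beur[OF N assms(5)])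
  obtain e :: 'n where True by blast
  define A where "A = (\<lambda>m. Lam_beur N \<inter> axis_jets M e m)"
  define C where "C = (\<lambda>m. lam_top N closure_of A m)"
  have "s \<le> t" if s: "(\<lambda>\<alpha>. s * b \<alpha> - x \<alpha>) \<in> C m" and t: "(\<lambda>\<alpha>. t * b \<alpha> - x \<alpha>) \<in> C m" for m x s t
  proof (rule ccontr)
    assume "\<not> s \<le> t"
    then have st: "s - t > 0" by simp
    define D where "D = 2 * (real (Suc m) * M 0) + 1"
    \<comment> \<open>The translation by \<open>x\<close> cancels in the difference, which has the
      positive coefficients \<open>(s - t) * sqrt (n j)\<close> along the axis.\<close>
    have bound: "(s - t) * sqrt (n j) / 2 * (1 / real (Suc m)) ^ j \<le> D" for j
      unfolding D_def
      by (rule axis_jets_closure_difference_bound[OF N M quasi s[unfolded C_def A_def] t[unfolded C_def A_def],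
            where c = "\<lambda>j. (s - t) * sqrt (n j)"])
        (use st n in \<open>auto simp: b_def mlen_single left_diff_distrib\<close>)
    have D: "D > 0" using M_pos[of 0] by (simp add: D_def add_pos_pos)
    \<comment> \<open>Chosen such that \<open>(s - t) / 2 * r\<close> equals
      \<open>(s - t) / 2 + D\<close> and so exceeds \<open>D\<close>. For large \<open>k\<close> the
      root of \<open>n k\<close> beats \<open>(r * Suc m) ^ k\<close>, which contradicts
      \<open>bound\<close>.\<close>
    define r where "r = 1 + 2 * D / (s - t)"
    have r: "r \<ge> 1" using D st by (simp add: r_def)
    have "eventually (\<lambda>k. ((r * real (Suc m))\<^sup>2) ^ k \<le> n k) sequentially"
      using assms(5) n by (intro root_at_top_imp_eventually_power_le) (auto simp: n_def)
    then have "eventually (\<lambda>k. ((r * real (Suc m))\<^sup>2) ^ k \<le> n k \<and> k > 0) sequentially"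
      using eventually_gt_at_top[of 0] by (rule eventually_conj)
    then obtain k where k: "((r * real (Suc m))\<^sup>2) ^ k \<le> n k" "k > 0"
      by (auto simp: eventually_sequentially)
    have "r \<le> r ^ k" using r k(2) by (simp add: self_le_power)
    also have "\<dots> = sqrt (((r * real (Suc m))\<^sup>2) ^ k) * (1 / real (Suc m)) ^ k"
      using r by (simp add: real_sqrt_power power_mult_distrib[symmetric])
    also have "\<dots> \<le> sqrt (n k) * (1 / real (Suc m)) ^ k"
      using k(1) by (intro mult_right_mono) auto
    finally have "(s - t) / 2 * r \<le> (s - t) / 2 * (sqrt (n k) * (1 / real (Suc m)) ^ k)"
      using st by (intro mult_left_mono) auto
    also have "\<dots> \<le> D" using bound[of k] by (simp add: mult_ac)
    finally have "(s - t) / 2 * r \<le> D" .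
    moreover have "(s - t) / 2 * r = (s - t) / 2 + D"
      using st by (simp add: r_def field_simps)
    ultimately show False using st by simp
  qed
  then have "haar_null_borel N (\<Union>m. C m)"
    by (intro haar_null_borel_UN_closed[OF N b]) (auto simp: C_def)
  moreover have "A m \<subseteq> C m" for m
    unfolding C_def by (rule closure_of_subset) (simp add: A_def topspace_lam_top)
  then have "jet_germ_roum M \<inter> Lam_beur N \<subseteq> (\<Union>m. C m)"
    using jet_germ_roum_subset_axis_jets[where e = e, OF M_pos] by (fastforce simp: A_def)
  ultimately show ?thesis unfolding haar_null_def by blast
qed

end
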